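(* Let $\mathcal{N}_{A\to B_1\cdots B_K}$ be a quantum broadcast channel with $K$ receivers, let $\mathscr{A}\subseteq 2^{[K]}$ be an access structure, and let $\mathcal{J}\cong\mathscr{A}$ index the associated compound quantum channel $\{\mathcal{N}^{(T)}_{A\to B_T}\}_{T\in\mathscr{A}}$, where $B_T=(B_k)_{k\in T}$ and $\mathcal{N}^{(T)}_{A\to B_T}=\mathrm{Tr}_{B_{T^c}}\circ\mathcal{N}_{A\to B_1\cdots B_K}$. Then the quantum secret sharing capacity of the broadcast channel for the access structure $\mathscr{A}$ equals the quantum capacity with informed decoder of the associated compound channel: $$C_{\mathrm{QSS}}(\mathscr{A})=Q(\mathcal{J}).$$
   Context: All Hilbert spaces are finite-dimensional, $\mathcal{L}(\mathcal{H})$ denotes the linear operators on $\mathcal{H}$, "channel" means completely positive trace-preserving map, and fidelity is $F(\rho,\sigma)=\|\sqrt{\rho}\sqrt{\sigma}\|_1^2$. $[K]=\{1,\dots,K\}$ and $T^c=[K]\setminus T$. Access structure: an adversary structure is a family $\mathscr{Z}\subseteq 2^{[K]}$ that is downward-closed ($Z\in\mathscr{Z}$, $Z'\subseteq Z$ imply $Z'\in\mathscr{Z}$) and self-dual ($Z\in\mathscr{Z}\iff Z^c\notin\mathscr{Z}$ for every $Z\subseteq[K]$). The corresponding access structure is $\mathscr{A}=2^{[K]}\setminus\mathscr{Z}$; its members are the qualified sets. Broadcast channel: a channel $\mathcal{N}_{A\to B_1\cdots B_K}:\mathcal{L}(\mathcal{H}_A)\to\mathcal{L}(\mathcal{H}_{B_1}\otimes\cdots\otimes\mathcal{H}_{B_K})$,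 used $n$ times as $\mathcal{N}^{\otimes n}$; participant $k$ receives $B_k^n$, and $B_T^n=(B_k^n)_{k\in T}$. QSS code: a $(2^{nR},n)$ QSS code consists of a secret space $\mathcal{H}_S$ of dimension $2^{nR}$ (when this is not a positive integer, read $\max\{1,\lfloor 2^{nR}\rfloor\}$), an encoding channel $\mathcal{F}_{S\to A^n}:\mathcal{L}(\mathcal{H}_S)\to\mathcal{L}(\mathcal{H}_A^{\otimes n})$, and decoding channels $\mathcal{D}^{(T)}_{B_T^n\to\widehat S}:\mathcal{L}(\mathcal{H}_{B_T}^{\otimes n})\to\mathcal{L}(\mathcal{H}_S)$ for each $T\in\mathscr{A}$. For a unit vector $|\phi\rangle_{S'S}\in\mathcal{H}_{S'}\otimes\mathcal{H}_S$ ($\mathcal{H}_{S'}\cong\mathcal{H}_S$ a reference), let $$\rho^{(T)}_{S'\widehat S B_{T^c}^n}=\big(\mathrm{id}_{S'}\otimes\mathcal{D}^{(T)}_{B_T^n\to\widehat S}\otimes\mathrm{id}_{B_{T^c}^n}\big)\big(\mathrm{id}_{S'}\otimes\mathcal{N}^{\otimes n}\circ\mathcal{F}\big)(|\phi\rangle\langle\phi|_{S'S}),$$ and let $\rho^{(T)}_{S'\widehat S}$ be its reduced state on $S'\widehat S$. QSS capacity: $R\ge0$ is an achievable QSS rate for $\mathscr{A}$ if for every $\varepsilon,\delta>0$ and every sufficiently large $n$ (depending on $\varepsilon,\delta,R$) there is a $(2^{n(R-\delta)},n)$ QSS code with $F(|\phi\rangle\langle\phi|_{S'S},\rho^{(T)}_{S'\widehat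 S})\ge1-\varepsilon$ for all $T\in\mathscr{A}$ and all unit vectors $|\phi\rangle_{S'S}$. $C_{\mathrm{QSS}}(\mathscr{A})$ is the supremum of achievable QSS rates. Quantum capacity of a compound channel $\{\mathcal{N}^{(\ell)}_{A\to B_\ell}\}_{\ell\in\mathcal{J}}$ ($\mathcal{J}$ finite) with informed decoder: a $(2^{nR},n)$ code consists of a message space $\mathcal{H}_S$ of dimension $2^{nR}$ (same rounding convention), one encoding channel $\mathcal{F}_{S\to A^n}$ and decoding channels $\mathcal{D}^{(\ell)}:\mathcal{L}(\mathcal{H}_{B_\ell}^{\otimes n})\to\mathcal{L}(\mathcal{H}_S)$, $\ell\in\mathcal{J}$. $R\ge0$ is achievable if for every $\varepsilon,\delta>0$ and every sufficiently large $n$ there is a $(2^{n(R-\delta)},n)$ code with $\min_{\ell\in\mathcal{J}}F\big(|\phi\rangle\langle\phi|_{S'S},(\mathrm{id}_{S'}\otimes\mathcal{D}^{(\ell)}\circ(\mathcal{N}^{(\ell)})^{\otimes n}\circ\mathcal{F})(|\phi\rangle\langle\phi|_{S'S})\big)\ge1-\varepsilon$ for all unit vectors $|\phi\rangle_{S'S}$. $Q(\mathcal{J})$ is the supremum of achievable rates. *)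

theory Defs
  imports "HOL-Analysis.Finite_Product_Measure" "HOL-Library.Nonpos_Ints"
begin

text \<open>
  A finite-dimensional Hilbert space is given by a finite set \<open>I\<close> labelling an orthonormal basis,
  i.e. it is the space of functions \<open>I \<rightarrow> complex\<close>.  Vectors and operators are represented by their
  coordinates in this basis, extended by zero outside \<open>I\<close>, so that equality of operators is
  equality of functions.  Label sets of tensor products are products of label sets:
  \<open>I \<times> J\<close> for two factors, and \<open>Pi\<^sub>E K I\<close> for a family of factors \<open>I k\<close> with \<open>k \<in> K\<close>.
\<close>

type_synonym 'i op = "'i \<Rightarrow> 'i \<Rightarrow> complex"
type_synonym ('i, 'j) superop = "'i op \<Rightarrow> 'j op"

definition ops :: "'i set \<Rightarrow> 'i op set" where
  "ops I = {X. \<forall>i j. X i j \<noteq> 0 \<longrightarrow> i \<in> I \<and> j \<in> I}"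

definition op_mult :: "'i set \<Rightarrow> 'i op \<Rightarrow> 'i op \<Rightarrow> 'i op" where
  "op_mult I X Y = (\<lambda>i j. \<Sum>k\<in>I. X i k * Y k j)"

definition op_adj :: "'i op \<Rightarrow> 'i op" where
  "op_adj X = (\<lambda>i j. cnj (X j i))"

definition op_trace :: "'i set \<Rightarrow> 'i op \<Rightarrow> complex" where
  "op_trace I X = (\<Sum>i\<in>I. X i i)"

definition unit_op :: "'i \<Rightarrow> 'i \<Rightarrow> 'i op" where
  "unit_op k l = (\<lambda>i j. if i = k \<and> j = l then 1 else 0)"

definition psd :: "'i set \<Rightarrow> 'i op \<Rightarrow> bool" where
  "psd I X \<longleftrightarrow> X \<in> ops I \<and>
     (\<forall>v. (\<Sum>i\<in>I. \<Sum>j\<in>I. cnj (v i) * X i j * v j) \<in> \<real>\<^sub>\<ge>\<^sub>0)"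

text \<open>For finite \<open>I\<close> and positive semidefinite \<open>X\<close> the following \<open>Y\<close> exists and is unique;
  the operator square root is only ever taken in this case.\<close>

definition op_sqrt :: "'i set \<Rightarrow> 'i op \<Rightarrow> 'i op" where
  "op_sqrt I X = (THE Y. psd I Y \<and> op_mult I Y Y = X)"

definition trace_norm :: "'i set \<Rightarrow> 'i op \<Rightarrow> real" where
  "trace_norm I X = Re (op_trace I (op_sqrt I (op_mult I (op_adj X) X)))"

definition fidelity :: "'i set \<Rightarrow> 'i op \<Rightarrow> 'i op \<Rightarrow> real" where
  "fidelity I \<rho> \<sigma> = (trace_norm I (op_mult I (op_sqrt I \<rho>) (op_sqrt I \<sigma>)))\<^sup>2"

definition unit_vec :: "'i set \<Rightarrow> ('i \<Rightarrow> complex) \<Rightarrow> bool" where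
  "unit_vec I \<phi> \<longleftrightarrow> (\<forall>i. i \<notin> I \<longrightarrow> \<phi> i = 0) \<and> (\<Sum>i\<in>I. (cmod (\<phi> i))\<^sup>2) = 1"

definition pure_state :: "('i \<Rightarrow> complex) \<Rightarrow> 'i op" where
  "pure_state \<phi> = (\<lambda>i j. \<phi> i * cnj (\<phi> j))"

text \<open>For linear \<open>\<Phi>\<close> on operators over \<open>I\<close> and \<open>\<Psi>\<close> on operators over \<open>J\<close>, this is the linear map
  \<open>\<Phi> \<otimes> \<Psi>\<close>, obtained by expanding the argument in the basis of tensor products of matrix units.\<close>

definition tensor_map ::
  "'i set \<Rightarrow> 'j set \<Rightarrow> ('i, 'k) superop \<Rightarrow> ('j, 'l) superop \<Rightarrow> ('i \<times> 'j, 'k \<times> 'l) superop" where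
  "tensor_map I J \<Phi> \<Psi> X = (\<lambda>(k, l) (k', l').
     \<Sum>i\<in>I. \<Sum>i'\<in>I. \<Sum>j\<in>J. \<Sum>j'\<in>J.
       X (i, j) (i', j') * \<Phi> (unit_op i i') k k' * \<Psi> (unit_op j j') l l')"

definition pow_space :: "nat \<Rightarrow> 'i set \<Rightarrow> (nat \<Rightarrow> 'i) set" where
  "pow_space n I = ({..<n} \<rightarrow>\<^sub>E I)"

text \<open>The \<open>n\<close>-fold tensor power of \<open>\<Phi>\<close>, which maps operators over \<open>I\<close> to operators over \<open>J\<close>.\<close>

definition tensor_pow ::
  "nat \<Rightarrow> 'i set \<Rightarrow> 'j set \<Rightarrow> ('i, 'j) superop \<Rightarrow> (nat \<Rightarrow> 'i, nat \<Rightarrow> 'j) superop" where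
  "tensor_pow n I J \<Phi> X = (\<lambda>f g.
     if f \<in> pow_space n J \<and> g \<in> pow_space n J
     then \<Sum>a\<in>pow_space n I. \<Sum>b\<in>pow_space n I.
            X a b * (\<Prod>t<n. \<Phi> (unit_op (a t) (b t)) (f t) (g t))
     else 0)"

definition linear_superop :: "'i set \<Rightarrow> 'j set \<Rightarrow> ('i, 'j) superop \<Rightarrow> bool" where
  "linear_superop I J \<Phi> \<longleftrightarrow>
     (\<forall>X\<in>ops I. \<Phi> X \<in> ops J) \<and>
     (\<forall>X\<in>ops I. \<forall>Y\<in>ops I. \<forall>a b.
        \<Phi> (\<lambda>i j. a * X i j + b * Y i j) = (\<lambda>i j. a * \<Phi> X i j + b * \<Phi> Y i j))"

definition completely_positive :: "'i set \<Rightarrow> 'j set \<Rightarrow> ('i, 'j) superop \<Rightarrow> bool" where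
  "completely_positive I J \<Phi> \<longleftrightarrow>
     (\<forall>d::nat. \<forall>X. psd ({..<d} \<times> I) X \<longrightarrow> psd ({..<d} \<times> J) (tensor_map {..<d} I id \<Phi> X))"

definition trace_preserving :: "'i set \<Rightarrow> 'j set \<Rightarrow> ('i, 'j) superop \<Rightarrow> bool" where
  "trace_preserving I J \<Phi> \<longleftrightarrow> (\<forall>X\<in>ops I. op_trace J (\<Phi> X) = op_trace I X)"

definition channel :: "'i set \<Rightarrow> 'j set \<Rightarrow> ('i, 'j) superop \<Rightarrow> bool" where
  "channel I J \<Phi> \<longleftrightarrow>
     linear_superop I J \<Phi> \<and> completely_positive I J \<Phi> \<and> trace_preserving I J \<Phi>"

definition partial_trace :: "'j set \<Rightarrow> ('i \<times> 'j, 'i) superop" where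
  "partial_trace J X = (\<lambda>i i'. \<Sum>j\<in>J. X (i, j) (i', j))"

text \<open>Identification of operators along a bijection \<open>\<pi>\<close> from \<open>J\<close> onto the original label set.\<close>

definition relabel :: "'j set \<Rightarrow> ('j \<Rightarrow> 'i) \<Rightarrow> ('i, 'j) superop" where
  "relabel J \<pi> X = (\<lambda>i j. if i \<in> J \<and> j \<in> J then X (\<pi> i) (\<pi> j) else 0)"

definition adversary_structure :: "nat \<Rightarrow> nat set set \<Rightarrow> bool" where
  "adversary_structure K \<Z> \<longleftrightarrow>
     \<Z> \<subseteq> Pow {1..K} \<and>
     (\<forall>Z\<in>\<Z>. \<forall>Z'. Z' \<subseteq> Z \<longrightarrow> Z' \<in> \<Z>) \<and>
     (\<forall>Z. Z \<subseteq> {1..K} \<longrightarrow> (Z \<in> \<Z> \<longleftrightarrow> {1..K} - Z \<notin> \<Z>))"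

definition access_structure :: "nat \<Rightarrow> nat set set \<Rightarrow> bool" where
  "access_structure K \<A> \<longleftrightarrow> (\<exists>\<Z>. adversary_structure K \<Z> \<and> \<A> = Pow {1..K} - \<Z>)"

text \<open>The system \<open>B\<^sub>T\<close> has label set \<open>Pi\<^sub>E T B\<close>.  The following two maps are the canonical
  identifications of \<open>B\<^sub>1 \<cdots> B\<^sub>K\<close> with \<open>B\<^sub>T B\<^sub>T\<^sub>c\<close>, and of its \<open>n\<close>-fold power with the tensor
  product of the \<open>n\<close>-fold powers of \<open>B\<^sub>T\<close> and \<open>B\<^sub>T\<^sub>c\<close>, where \<open>T\<^sub>c = {1..K} - T\<close>.\<close>

definition split_systems ::
  "nat \<Rightarrow> (nat \<Rightarrow> 'b set) \<Rightarrow> nat set \<Rightarrow> (nat \<Rightarrow> 'b, (nat \<Rightarrow> 'b) \<times> (nat \<Rightarrow> 'b)) superop" where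
  "split_systems K B T =
     relabel (Pi\<^sub>E T B \<times> Pi\<^sub>E ({1..K} - T) B) (merge T ({1..K} - T))"

definition split_systems_pow ::
  "nat \<Rightarrow> nat \<Rightarrow> (nat \<Rightarrow> 'b set) \<Rightarrow> nat set \<Rightarrow>
     (nat \<Rightarrow> nat \<Rightarrow> 'b, (nat \<Rightarrow> nat \<Rightarrow> 'b) \<times> (nat \<Rightarrow> nat \<Rightarrow> 'b)) superop" where
  "split_systems_pow n K B T =
     relabel (pow_space n (Pi\<^sub>E T B) \<times> pow_space n (Pi\<^sub>E ({1..K} - T) B))
       (\<lambda>(g, h). \<lambda>t\<in>{..<n}. merge T ({1..K} - T) (g t, h t))"

definition marginal_channel ::
  "nat \<Rightarrow> (nat \<Rightarrow> 'b set) \<Rightarrow> ('a, nat \<Rightarrow> 'b) superop \<Rightarrow> nat set \<Rightarrow> ('a, nat \<Rightarrow> 'b) superop" where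
  "marginal_channel K B N T = partial_trace (Pi\<^sub>E ({1..K} - T) B) \<circ> split_systems K B T \<circ> N"

text \<open>The dimension of the message space of a \<open>(2\<^bsup>nR\<^esup>, n)\<close> code; \<open>R\<close> may be negative.\<close>

definition code_dim :: "nat \<Rightarrow> real \<Rightarrow> nat" where
  "code_dim n R = max 1 (nat \<lfloor>2 powr (real n * R)\<rfloor>)"

definition qss_code ::
  "'a set \<Rightarrow> (nat \<Rightarrow> 'b set) \<Rightarrow> nat set set \<Rightarrow> real \<Rightarrow> nat \<Rightarrow> (nat, nat \<Rightarrow> 'a) superop \<Rightarrow>
     (nat set \<Rightarrow> (nat \<Rightarrow> nat \<Rightarrow> 'b, nat) superop) \<Rightarrow> bool" where
  "qss_code A B \<A> R n F D \<longleftrightarrow>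
     channel {..<code_dim n R} (pow_space n A) F \<and>
     (\<forall>T\<in>\<A>. channel (pow_space n (Pi\<^sub>E T B)) {..<code_dim n R} (D T))"

text \<open>The state of the reference, the decoded secret and the systems of the other participants,
  in this order; \<open>d\<close> is the dimension of the secret space.\<close>

definition qss_state ::
  "'a set \<Rightarrow> (nat \<Rightarrow> 'b set) \<Rightarrow> nat \<Rightarrow> ('a, nat \<Rightarrow> 'b) superop \<Rightarrow> nat \<Rightarrow> nat \<Rightarrow>
     (nat, nat \<Rightarrow> 'a) superop \<Rightarrow> (nat set \<Rightarrow> (nat \<Rightarrow> nat \<Rightarrow> 'b, nat) superop) \<Rightarrow>
     nat set \<Rightarrow> (nat \<times> nat \<Rightarrow> complex) \<Rightarrow> (nat \<times> (nat \<times> (nat \<Rightarrow> nat \<Rightarrow> 'b))) op" where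
  "qss_state A B K N n d F D T \<phi> =
     (let S = {..<d};
          BT = pow_space n (Pi\<^sub>E T B);
          BTc = pow_space n (Pi\<^sub>E ({1..K} - T) B);
          \<rho> = tensor_map S S id (tensor_pow n A (Pi\<^sub>E {1..K} B) N \<circ> F) (pure_state \<phi>);
          \<rho>' = tensor_map S (pow_space n (Pi\<^sub>E {1..K} B)) id (split_systems_pow n K B T) \<rho>
      in tensor_map S (BT \<times> BTc) id (tensor_map BT BTc (D T) id) \<rho>')"

definition qss_reduced_state ::
  "'a set \<Rightarrow> (nat \<Rightarrow> 'b set) \<Rightarrow> nat \<Rightarrow> ('a, nat \<Rightarrow> 'b) superop \<Rightarrow> nat \<Rightarrow> nat \<Rightarrow>
     (nat, nat \<Rightarrow> 'a) superop \<Rightarrow> (nat set \<Rightarrow> (nat \<Rightarrow> nat \<Rightarrow> 'b, nat) superop) \<Rightarrow>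
     nat set \<Rightarrow> (nat \<times> nat \<Rightarrow> complex) \<Rightarrow> (nat \<times> nat) op" where
  "qss_reduced_state A B K N n d F D T \<phi> =
     (let S = {..<d}; BTc = pow_space n (Pi\<^sub>E ({1..K} - T) B)
      in tensor_map S (S \<times> BTc) id (partial_trace BTc) (qss_state A B K N n d F D T \<phi>))"

definition qss_achievable ::
  "'a set \<Rightarrow> (nat \<Rightarrow> 'b set) \<Rightarrow> nat \<Rightarrow> ('a, nat \<Rightarrow> 'b) superop \<Rightarrow> nat set set \<Rightarrow> real \<Rightarrow> bool" where
  "qss_achievable A B K N \<A> R \<longleftrightarrow> R \<ge> 0 \<and>
     (\<forall>\<epsilon>>0. \<forall>\<delta>>0. \<forall>\<^sub>F n in sequentially. \<exists>F D.
        qss_code A B \<A> (R - \<delta>) n F D \<and>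
        (\<forall>T\<in>\<A>. \<forall>\<phi>.
           let d = code_dim n (R - \<delta>) in
           unit_vec ({..<d} \<times> {..<d}) \<phi> \<longrightarrow>
           fidelity ({..<d} \<times> {..<d}) (pure_state \<phi>) (qss_reduced_state A B K N n d F D T \<phi>)
             \<ge> 1 - \<epsilon>))"

text \<open>Suprema of rates are taken in \<open>ereal\<close>, so that boundedness of the rates is not presupposed.\<close>

definition qss_capacity ::
  "'a set \<Rightarrow> (nat \<Rightarrow> 'b set) \<Rightarrow> nat \<Rightarrow> ('a, nat \<Rightarrow> 'b) superop \<Rightarrow> nat set set \<Rightarrow> ereal" where
  "qss_capacity A B K N \<A> = Sup (ereal ` {R. qss_achievable A B K N \<A> R})"

text \<open>A compound channel is a family of channels \<open>M l\<close> from operators over \<open>A\<close> to operators over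
  \<open>C l\<close>, indexed by \<open>l\<close> in a finite nonempty set \<open>J\<close>.\<close>

definition compound_code ::
  "'a set \<Rightarrow> ('l \<Rightarrow> 'c set) \<Rightarrow> 'l set \<Rightarrow> real \<Rightarrow> nat \<Rightarrow> (nat, nat \<Rightarrow> 'a) superop \<Rightarrow>
     ('l \<Rightarrow> (nat \<Rightarrow> 'c, nat) superop) \<Rightarrow> bool" where
  "compound_code A C J R n F D \<longleftrightarrow>
     channel {..<code_dim n R} (pow_space n A) F \<and>
     (\<forall>l\<in>J. channel (pow_space n (C l)) {..<code_dim n R} (D l))"

definition compound_state ::
  "'a set \<Rightarrow> ('l \<Rightarrow> 'c set) \<Rightarrow> ('l \<Rightarrow> ('a, 'c) superop) \<Rightarrow> nat \<Rightarrow> nat \<Rightarrow>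
     (nat, nat \<Rightarrow> 'a) superop \<Rightarrow> ('l \<Rightarrow> (nat \<Rightarrow> 'c, nat) superop) \<Rightarrow>
     'l \<Rightarrow> (nat \<times> nat \<Rightarrow> complex) \<Rightarrow> (nat \<times> nat) op" where
  "compound_state A C M n d F D l \<phi> =
     tensor_map {..<d} {..<d} id (D l \<circ> tensor_pow n A (C l) (M l) \<circ> F) (pure_state \<phi>)"

definition compound_achievable ::
  "'a set \<Rightarrow> ('l \<Rightarrow> 'c set) \<Rightarrow> ('l \<Rightarrow> ('a, 'c) superop) \<Rightarrow> 'l set \<Rightarrow> real \<Rightarrow> bool" where
  "compound_achievable A C M J R \<longleftrightarrow> R \<ge> 0 \<and>
     (\<forall>\<epsilon>>0. \<forall>\<delta>>0. \<forall>\<^sub>F n in sequentially. \<exists>F D.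
        compound_code A C J (R - \<delta>) n F D \<and>
        (\<forall>\<phi>.
           let d = code_dim n (R - \<delta>) in
           unit_vec ({..<d} \<times> {..<d}) \<phi> \<longrightarrow>
           (MIN l\<in>J. fidelity ({..<d} \<times> {..<d}) (pure_state \<phi>) (compound_state A C M n d F D l \<phi>))
             \<ge> 1 - \<epsilon>))"

definition compound_capacity ::
  "'a set \<Rightarrow> ('l \<Rightarrow> 'c set) \<Rightarrow> ('l \<Rightarrow> ('a, 'c) superop) \<Rightarrow> 'l set \<Rightarrow> ereal" where
  "compound_capacity A C M J = Sup (ereal ` {R. compound_achievable A C M J R})"

end

theory Submission imports Defs begin

text \<open>
  Neither the encoder nor the decoders are constrained by secrecy, so the two capacities are suprema
  over the same codes, and it suffices that each code has the same output state in both settings.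
  Discarding \<open>B\<^sub>T\<^sub>c\<close> commutes with decoding on \<open>B\<^sub>T\<close>, and discarding it from the \<open>n\<close>-fold power of
  the broadcast channel leaves the \<open>n\<close>-fold power of the marginal channel.
\<close>

section \<open>Linear superoperators and matrix units\<close>

lemma unit_op_in_ops: "k \<in> I \<Longrightarrow> l \<in> I \<Longrightarrow> unit_op k l \<in> ops I"
  by (auto simp: ops_def unit_op_def)

lemma opsI: "(\<And>i j. i \<notin> I \<or> j \<notin> I \<Longrightarrow> X i j = 0) \<Longrightarrow> X \<in> ops I"
  by (auto simp: ops_def)

lemma ops_outside: "X \<in> ops I \<Longrightarrow> i \<notin> I \<or> j \<notin> I \<Longrightarrow> X i j = 0"
  by (auto simp: ops_def)

lemma linear_superop_ops: "linear_superop I J \<Phi> \<Longrightarrow> X \<in> ops I \<Longrightarrow> \<Phi> X \<in> ops J"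
  by (simp add: linear_superop_def)

lemma linear_superop_linear:
  "linear_superop I J \<Phi> \<Longrightarrow> X \<in> ops I \<Longrightarrow> Y \<in> ops I \<Longrightarrow>
    \<Phi> (\<lambda>i j. a * X i j + b * Y i j) = (\<lambda>i j. a * \<Phi> X i j + b * \<Phi> Y i j)"
  by (simp add: linear_superop_def)

lemma linear_superop_zero:
  assumes "linear_superop I J \<Phi>"
  shows "\<Phi> (\<lambda>i j. 0) = (\<lambda>i j. 0)"
proof -
  define Z :: "'a op" where "Z = (\<lambda>i j. 0)"
  have "Z \<in> ops I" by (simp add: Z_def ops_def)
  then show ?thesis
    using linear_superop_linear[OF assms, of Z Z 0 0] by simp
qed

lemma linear_superop_sum:
  assumes lin: "linear_superop I J \<Phi>" and "finite S" and "\<And>s. s \<in> S \<Longrightarrow> E s \<in> ops I"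
  shows "\<Phi> (\<lambda>i j. \<Sum>s\<in>S. c s * E s i j) = (\<lambda>k l. \<Sum>s\<in>S. c s * \<Phi> (E s) k l)"
  using assms(2,3)
proof (induction S rule: finite_induct)
  case empty
  then show ?case using linear_superop_zero[OF lin] by simp
next
  case (insert s S)
  let ?Y = "\<lambda>i j. \<Sum>s\<in>S. c s * E s i j"
  \<comment> \<open>Linearity is available only for arguments in \<open>ops I\<close>, so the
    partial sum has to be known to lie there before the two-term rule applies with coefficients
    \<open>c s\<close> and 1.\<close>
  have Y: "?Y \<in> ops I"
    using insert.prems by (intro opsI sum.neutral ballI) (auto intro: ops_outside)
  have "E s \<in> ops I" using insert.prems by blast
  from linear_superop_linear[OF lin this Y, of "c s" 1] show ?case
    using insert by simp
qed

text \<open>\<open>tensor_map\<close> and \<open>tensor_pow\<close> see a superoperator only through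
  its values on matrix units. This expansion leads from such sums back to \<open>\<Phi> X\<close>
  itself. It rests on \<open>X\<close> being the finite sum of its entries times matrix units, which
  holds because \<open>X\<close> vanishes outside \<open>I\<close>.\<close>

lemma linear_superop_expand:
  assumes lin: "linear_superop I J \<Phi>" and fin: "finite I" and X: "X \<in> ops I"
  shows "\<Phi> X k l = (\<Sum>i\<in>I. \<Sum>j\<in>I. X i j * \<Phi> (unit_op i j) k l)"
proof -
  \<comment> \<open>Pairs serve as a single index, the form that \<open>linear_superop_sum\<close>
    expects; the double sum is restored at the end.\<close>
  let ?c = "\<lambda>s. X (fst s) (snd s)" and ?E = "\<lambda>s. unit_op (fst s) (snd s)"
  have "(\<Sum>s\<in>I \<times> I. ?c s * ?E s i j) = X i j" for i j
  proof -
    have "(\<Sum>s\<in>I \<times> I. ?c s * ?E s i j) = (\<Sum>s\<in>I \<times> I. if s = (i, j) then X i j else 0)"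
      by (intro sum.cong) (auto simp: unit_op_def)
    also have "\<dots> = X i j" using fin ops_outside[OF X] by auto
    finally show ?thesis .
  qed
  then have "\<Phi> X = \<Phi> (\<lambda>i j. \<Sum>s\<in>I \<times> I. ?c s * ?E s i j)" by simp
  also have "\<dots> = (\<lambda>k l. \<Sum>s\<in>I \<times> I. ?c s * \<Phi> (?E s) k l)"
    by (rule linear_superop_sum[OF lin]) (auto simp: fin intro: unit_op_in_ops)
  finally show ?thesis by (simp add: sum.cartesian_product case_prod_beta)
qed

lemma linear_superop_id: "linear_superop I I id"
  by (simp add: linear_superop_def)

lemma linear_superop_comp:
  "linear_superop J L \<Psi> \<Longrightarrow> linear_superop I J \<Phi> \<Longrightarrow> linear_superop I L (\<Psi> \<circ> \<Phi>)"
  by (simp add: linear_superop_def)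

lemma linear_superop_relabel: "linear_superop I J (relabel J \<pi>)"
  by (auto simp: linear_superop_def relabel_def ops_def fun_eq_iff)

lemma linear_superop_partial_trace: "linear_superop (I \<times> J) I (partial_trace J)"
  unfolding linear_superop_def partial_trace_def
  by (auto simp: sum.distrib sum_distrib_left ops_outside intro!: opsI sum.neutral)

text \<open>\<open>\<Phi>\<close> enters the defining formula only through fixed coefficients, so
  the formula is linear in its argument by itself, and its \<open>else 0\<close> confines the output
  to the label set.\<close>

lemma linear_superop_tensor_pow: "linear_superop (pow_space n I) (pow_space n J) (tensor_pow n I J \<Phi>)"
  by (auto simp: linear_superop_def tensor_pow_def ops_def sum.distrib sum_distrib_left
      distrib_right mult.assoc fun_eq_iff)

text \<open>\<open>tensor_map\<close> contains no cutoff, so the support of the output must come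
  from the factors: a label outside \<open>K \<times> L\<close> makes the entry of
  \<open>\<Phi>\<close> or that of \<open>\<Psi>\<close> vanish in every summand.\<close>

lemma linear_superop_tensor_map:
  assumes "linear_superop I K \<Phi>" and "linear_superop J L \<Psi>"
  shows "linear_superop (I \<times> J) (K \<times> L) (tensor_map I J \<Phi> \<Psi>)"
proof -
  have "tensor_map I J \<Phi> \<Psi> X \<in> ops (K \<times> L)" for X
  proof -
    have "\<Phi> (unit_op i i') k k' * \<Psi> (unit_op j j') l l' = 0"
      if "i \<in> I" "i' \<in> I" "j \<in> J" "j' \<in> J" "\<not> ((k, l) \<in> K \<times> L \<and> (k', l') \<in> K \<times> L)"
      for i i' j j' k k' l l'
      using that ops_outside[OF linear_superop_ops[OF assms(1) unit_op_in_ops], of i i' k k']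
        ops_outside[OF linear_superop_ops[OF assms(2) unit_op_in_ops], of j j' l l'] by auto
    then have "tensor_map I J \<Phi> \<Psi> X (k, l) (k', l') = 0"
      if "\<not> ((k, l) \<in> K \<times> L \<and> (k', l') \<in> K \<times> L)" for k l k' l'
      unfolding tensor_map_def prod.case mult.assoc using that
      by (intro sum.neutral ballI) simp
    then show ?thesis unfolding ops_def by (clarsimp, blast)
  qed
  then show ?thesis
    by (simp add: linear_superop_def tensor_map_def fun_eq_iff sum.distrib sum_distrib_left
        distrib_right mult.assoc)
qed

section \<open>Tensor products with an identity map\<close>

lemma sum_unit_op:
  assumes "finite S" and "a \<in> S" and "a' \<in> S"
  shows "(\<Sum>i\<in>S. \<Sum>i'\<in>S. f i i' * unit_op i i' a a') = f a a'"
proof -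
  have "(\<Sum>i'\<in>S. f i i' * unit_op i i' a a') = (if i = a then f a a' else 0)" for i
    using assms by (auto simp: unit_op_def if_distrib[of "(*) _"] cong: if_cong)
  then show ?thesis using assms by simp
qed

text \<open>An operator on a tensor product is viewed as a matrix of blocks indexed by the first
  factor, here the reference system. The indices are unrestricted, so the blocks determine the
  operator by extensionality.\<close>

definition slice :: "('s \<times> 'i) op \<Rightarrow> 's \<Rightarrow> 's \<Rightarrow> 'i op" where
  "slice X a a' = (\<lambda>i i'. X (a, i) (a', i'))"

lemma op_eq_sliceI: "(\<And>a a'. slice X a a' = slice Y a a') \<Longrightarrow> X = Y"
  by (auto simp: slice_def fun_eq_iff)

lemma slice_ops: "X \<in> ops (S \<times> I) \<Longrightarrow> slice X a a' \<in> ops I"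
  by (auto simp: slice_def ops_def)

text \<open>The map \<open>id \<otimes> \<Psi>\<close> acts on each block separately. This removes
  the reference system from every later computation.\<close>

lemma slice_tensor_map:
  assumes lin: "linear_superop J L \<Psi>" and fin: "finite S" "finite J" and X: "X \<in> ops (S \<times> J)"
  shows "slice (tensor_map S J id \<Psi> X) a a' = \<Psi> (slice X a a')"
proof (cases "a \<in> S \<and> a' \<in> S")
  case True
  show ?thesis
  proof (intro ext)
    fix l l'
    have "slice (tensor_map S J id \<Psi> X) a a' l l' =
        (\<Sum>i\<in>S. \<Sum>i'\<in>S. (\<Sum>j\<in>J. \<Sum>j'\<in>J. X (i, j) (i', j') * \<Psi> (unit_op j j') l l') * unit_op i i' a a')"
      unfolding sum_distrib_right slice_def tensor_map_def prod.case id_apply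
      by (intro sum.cong refl) (simp only: mult_ac)
    also have "\<dots> = (\<Sum>j\<in>J. \<Sum>j'\<in>J. slice X a a' j j' * \<Psi> (unit_op j j') l l')"
      using True fin by (simp add: sum_unit_op slice_def)
    also have "\<dots> = \<Psi> (slice X a a') l l'"
      by (rule linear_superop_expand[OF lin fin(2) slice_ops[OF X], symmetric])
    finally show "slice (tensor_map S J id \<Psi> X) a a' l l' = \<Psi> (slice X a a') l l'" .
  qed
next
  case False
  \<comment> \<open>For indices outside \<open>S\<close> both sides are zero: the input block by the
    support of \<open>X\<close>, the output block by the support of the image.\<close>
  have "slice X a a' = (\<lambda>i j. 0)" using X False by (auto simp: slice_def ops_def fun_eq_iff)
  moreover have "tensor_map S J id \<Psi> X \<in> ops (S \<times> L)"
    by (rule linear_superop_ops[OF linear_superop_tensor_map[OF linear_superop_id lin] X])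
  then have "slice (tensor_map S J id \<Psi> X) a a' = (\<lambda>i j. 0)"
    using False by (auto simp: slice_def ops_def fun_eq_iff)
  ultimately show ?thesis using linear_superop_zero[OF lin] by simp
qed

text \<open>The trace reads only entries diagonal in \<open>L\<close>. There the \<open>id\<close>
  factor fixes both inner \<open>L\<close> labels to the same \<open>l\<close>, so the sum over
  \<open>l\<close> falls on \<open>X\<close> alone and the rest is the matrix unit expansion of
  \<open>\<Phi>\<close>.\<close>

lemma partial_trace_tensor_map:
  assumes lin: "linear_superop I J \<Phi>" and fin: "finite I" "finite L" and X: "X \<in> ops (I \<times> L)"
  shows "partial_trace L (tensor_map I L \<Phi> id X) = \<Phi> (partial_trace L X)"
proof (intro ext)
  fix k k'
  have "tensor_map I L \<Phi> id X (k, l) (k', l) =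
      (\<Sum>i\<in>I. \<Sum>i'\<in>I. X (i, l) (i', l) * \<Phi> (unit_op i i') k k')" if "l \<in> L" for l
    by (simp add: tensor_map_def sum_unit_op[OF fin(2) that that])
  then have "partial_trace L (tensor_map I L \<Phi> id X) k k' =
      (\<Sum>l\<in>L. \<Sum>i\<in>I. \<Sum>i'\<in>I. X (i, l) (i', l) * \<Phi> (unit_op i i') k k')"
    by (simp add: partial_trace_def)
  also have "\<dots> = (\<Sum>i\<in>I. \<Sum>i'\<in>I. \<Sum>l\<in>L. X (i, l) (i', l) * \<Phi> (unit_op i i') k k')"
    by (subst sum.swap) (intro sum.cong refl sum.swap)
  also have "\<dots> = (\<Sum>i\<in>I. \<Sum>i'\<in>I. partial_trace L X i i' * \<Phi> (unit_op i i') k k')"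
    by (simp add: partial_trace_def sum_distrib_right)
  also have "\<dots> = \<Phi> (partial_trace L X) k k'"
    by (rule linear_superop_expand[OF lin fin(1), symmetric])
      (rule linear_superop_ops[OF linear_superop_partial_trace X])
  finally show "partial_trace L (tensor_map I L \<Phi> id X) k k' = \<Phi> (partial_trace L X) k k'" .
qed

section \<open>Marginal channels and output states of a code\<close>

lemma merge_pow_space:
  assumes "T \<subseteq> {1..K}" and "f \<in> pow_space n (Pi\<^sub>E T B)"
    and "h \<in> pow_space n (Pi\<^sub>E ({1..K} - T) B)"
  shows "(\<lambda>t\<in>{..<n}. merge T ({1..K} - T) (f t, h t)) \<in> pow_space n (Pi\<^sub>E {1..K} B)"
proof -
  have "merge T ({1..K} - T) (f t, h t) \<in> Pi\<^sub>E {1..K} B" if "t < n" for t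
  proof -
    have "merge T ({1..K} - T) (f t, h t) \<in> Pi\<^sub>E (T \<union> ({1..K} - T)) B"
      using assms that by (subst PiE_cancel_merge) (auto simp: pow_space_def)
    moreover have "T \<union> ({1..K} - T) = {1..K}" using assms(1) by blast
    ultimately show ?thesis by simp
  qed
  then show ?thesis by (auto simp: pow_space_def)
qed

text \<open>A label of the discarded systems is a tuple \<open>h\<close>, and the factor of channel
  use \<open>t\<close> depends on \<open>h\<close> only through \<open>h t\<close>. Hence the sum
  over all tuples of a product is the product over \<open>t\<close> of single-use sums, and each
  such sum is an entry of the marginal channel.\<close>

lemma partial_trace_split_systems_tensor_pow:
  fixes N :: "('a, nat \<Rightarrow> 'b) superop"
  assumes T: "T \<subseteq> {1..K}" and fin: "\<And>k. k \<in> {1..K} \<Longrightarrow> finite (B k)"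
  shows "partial_trace (pow_space n (Pi\<^sub>E ({1..K} - T) B))
           (split_systems_pow n K B T (tensor_pow n A (Pi\<^sub>E {1..K} B) N Y)) =
         tensor_pow n A (Pi\<^sub>E T B) (marginal_channel K B N T) Y"
proof (intro ext)
  fix f g :: "nat \<Rightarrow> nat \<Rightarrow> 'b"
  let ?C = "Pi\<^sub>E ({1..K} - T) B" and ?BT = "pow_space n (Pi\<^sub>E T B)" and ?P = "pow_space n A"
  let ?m = "\<lambda>f h. \<lambda>t\<in>{..<n}. merge T ({1..K} - T) (f t, h t)"
  let ?M = "\<lambda>a b t h. N (unit_op (a t) (b t)) (merge T ({1..K} - T) (f t, h)) (merge T ({1..K} - T) (g t, h))"
  show "partial_trace (pow_space n ?C)
           (split_systems_pow n K B T (tensor_pow n A (Pi\<^sub>E {1..K} B) N Y)) f g =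
         tensor_pow n A (Pi\<^sub>E T B) (marginal_channel K B N T) Y f g"
  proof (cases "f \<in> ?BT \<and> g \<in> ?BT")
    case False
    then show ?thesis
      by (auto simp: partial_trace_def split_systems_pow_def relabel_def tensor_pow_def)
  next
    case True
    have finC: "finite ?C" using fin by (intro finite_PiE) auto
    have "partial_trace (pow_space n ?C)
           (split_systems_pow n K B T (tensor_pow n A (Pi\<^sub>E {1..K} B) N Y)) f g =
        (\<Sum>h\<in>pow_space n ?C. tensor_pow n A (Pi\<^sub>E {1..K} B) N Y (?m f h) (?m g h))"
      using True by (simp add: partial_trace_def split_systems_pow_def relabel_def)
    also have "\<dots> = (\<Sum>h\<in>pow_space n ?C. \<Sum>a\<in>?P. \<Sum>b\<in>?P. Y a b * (\<Prod>t<n. ?M a b t (h t)))"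
    proof (intro sum.cong refl)
      fix h assume "h \<in> pow_space n ?C"
      \<comment> \<open>Membership of both merged labels selects the nonzero branch of
        \<open>tensor_pow\<close>.\<close>
      then have "?m f h \<in> pow_space n (Pi\<^sub>E {1..K} B)" "?m g h \<in> pow_space n (Pi\<^sub>E {1..K} B)"
        using True merge_pow_space[OF T] by blast+
      then have "tensor_pow n A (Pi\<^sub>E {1..K} B) N Y (?m f h) (?m g h) =
          (\<Sum>a\<in>?P. \<Sum>b\<in>?P. Y a b * (\<Prod>t<n. N (unit_op (a t) (b t)) (?m f h t) (?m g h t)))"
        unfolding tensor_pow_def by (simp only: simp_thms if_True)
      then show "tensor_pow n A (Pi\<^sub>E {1..K} B) N Y (?m f h) (?m g h) =
          (\<Sum>a\<in>?P. \<Sum>b\<in>?P. Y a b * (\<Prod>t<n. ?M a b t (h t)))" by simp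
    qed
    also have "\<dots> = (\<Sum>a\<in>?P. \<Sum>b\<in>?P. \<Sum>h\<in>pow_space n ?C. Y a b * (\<Prod>t<n. ?M a b t (h t)))"
      by (subst sum.swap) (intro sum.cong refl sum.swap)
    also have "\<dots> = (\<Sum>a\<in>?P. \<Sum>b\<in>?P. Y a b * (\<Prod>t<n. \<Sum>h\<in>?C. ?M a b t h))"
      using finC by (simp add: prod_sum_PiE pow_space_def sum_distrib_left)
    also have "\<dots> = (\<Sum>a\<in>?P. \<Sum>b\<in>?P. Y a b *
        (\<Prod>t<n. marginal_channel K B N T (unit_op (a t) (b t)) (f t) (g t)))"
    proof -
      \<comment> \<open>The \<open>relabel\<close> inside \<open>marginal_channel\<close> cuts off
        outside \<open>Pi\<^sub>E T B\<close>, so these memberships are what lets its entries unfold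
        to the sums over \<open>?C\<close>.\<close>
      have "f t \<in> Pi\<^sub>E T B" "g t \<in> Pi\<^sub>E T B" if "t < n" for t
        using True that by (auto simp: pow_space_def PiE_mem)
      then show ?thesis
        by (intro sum.cong refl arg_cong2[of _ _ _ _ "(*)"] prod.cong)
          (simp add: marginal_channel_def partial_trace_def split_systems_def relabel_def)
    qed
    also have "\<dots> = tensor_pow n A (Pi\<^sub>E T B) (marginal_channel K B N T) Y f g"
      using True by (simp add: tensor_pow_def)
    finally show ?thesis .
  qed
qed

text \<open>All maps involved act as the identity on the reference, so it suffices to compare
  blocks. On one block the claim is that decoding and then discarding equals discarding and then
  decoding, followed by the reduction of the power channel to its marginal.\<close>

lemma qss_reduced_state_eq_compound_state:
  assumes fin: "finite A" "\<And>k. k \<in> {1..K} \<Longrightarrow> finite (B k)" and T: "T \<subseteq> {1..K}"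
    and F: "linear_superop {..<d} (pow_space n A) F"
    and D: "linear_superop (pow_space n (Pi\<^sub>E T B)) {..<d} (D T)"
    and \<phi>: "pure_state \<phi> \<in> ops ({..<d} \<times> {..<d})"
  shows "qss_reduced_state A B K N n d F D T \<phi> =
         compound_state A (\<lambda>T. Pi\<^sub>E T B) (marginal_channel K B N) n d F D T \<phi>"
proof (rule op_eq_sliceI)
  fix a a'
  let ?S = "{..<d}" and ?B = "pow_space n (Pi\<^sub>E {1..K} B)"
  let ?BT = "pow_space n (Pi\<^sub>E T B)" and ?BTc = "pow_space n (Pi\<^sub>E ({1..K} - T) B)"
  let ?split = "split_systems_pow n K B T"
  define \<rho> where "\<rho> = tensor_map ?S ?S id (tensor_pow n A (Pi\<^sub>E {1..K} B) N \<circ> F) (pure_state \<phi>)"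
  define \<rho>' where "\<rho>' = tensor_map ?S ?B id ?split \<rho>"
  define \<rho>'' where "\<rho>'' = tensor_map ?S (?BT \<times> ?BTc) id (tensor_map ?BT ?BTc (D T) id) \<rho>'"
  have finB: "finite (pow_space n (Pi\<^sub>E U B))" if "U \<subseteq> {1..K}" for U
    unfolding pow_space_def using that fin(2) finite_subset[OF that]
    by (intro finite_PiE) auto
  have finBs: "finite ?B" "finite ?BT" "finite ?BTc" using T finB by auto
  note lin_tensor = linear_superop_tensor_map[OF linear_superop_id]
  have lin_NF: "linear_superop ?S ?B (tensor_pow n A (Pi\<^sub>E {1..K} B) N \<circ> F)"
    by (rule linear_superop_comp[OF linear_superop_tensor_pow F])
  have lin_split: "linear_superop ?B (?BT \<times> ?BTc) ?split"
    unfolding split_systems_pow_def by (rule linear_superop_relabel)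
  have lin_D: "linear_superop (?BT \<times> ?BTc) (?S \<times> ?BTc) (tensor_map ?BT ?BTc (D T) id)"
    by (rule linear_superop_tensor_map[OF D linear_superop_id])
  have lin_M: "linear_superop ?S ?S (D T \<circ> tensor_pow n A (Pi\<^sub>E T B) (marginal_channel K B N T) \<circ> F)"
    unfolding comp_assoc by (intro linear_superop_comp[OF D] linear_superop_comp[OF linear_superop_tensor_pow F])
  have \<rho>: "\<rho> \<in> ops (?S \<times> ?B)"
    unfolding \<rho>_def by (rule linear_superop_ops[OF lin_tensor[OF lin_NF] \<phi>])
  have \<rho>': "\<rho>' \<in> ops (?S \<times> (?BT \<times> ?BTc))"
    unfolding \<rho>'_def by (rule linear_superop_ops[OF lin_tensor[OF lin_split] \<rho>])
  have \<rho>'': "\<rho>'' \<in> ops (?S \<times> (?S \<times> ?BTc))"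
    unfolding \<rho>''_def by (rule linear_superop_ops[OF lin_tensor[OF lin_D] \<rho>'])
  \<comment> \<open>The encoded block at \<open>a\<close>, \<open>a'\<close>: the common input to
    which both settings apply their channel powers.\<close>
  define Y where "Y = F (slice (pure_state \<phi>) a a')"
  have s1: "slice \<rho> a a' = tensor_pow n A (Pi\<^sub>E {1..K} B) N Y"
    unfolding \<rho>_def Y_def using slice_tensor_map[OF lin_NF _ _ \<phi>] by simp
  have s2: "slice \<rho>' a a' = ?split (slice \<rho> a a')"
    unfolding \<rho>'_def by (rule slice_tensor_map[OF lin_split _ finBs(1) \<rho>]) simp
  have s3: "slice \<rho>'' a a' = tensor_map ?BT ?BTc (D T) id (slice \<rho>' a a')"
    unfolding \<rho>''_def
    by (rule slice_tensor_map[OF lin_D finite_lessThan finite_cartesian_product[OF finBs(2,3)] \<rho>'])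
  have "slice (qss_reduced_state A B K N n d F D T \<phi>) a a' =
      slice (tensor_map ?S (?S \<times> ?BTc) id (partial_trace ?BTc) \<rho>'') a a'"
    by (simp add: qss_reduced_state_def qss_state_def Let_def \<rho>_def \<rho>'_def \<rho>''_def)
  also have "\<dots> = partial_trace ?BTc (slice \<rho>'' a a')"
    by (rule slice_tensor_map[OF linear_superop_partial_trace finite_lessThan
          finite_cartesian_product[OF finite_lessThan finBs(3)] \<rho>''])
  also have "\<dots> = D T (partial_trace ?BTc (slice \<rho>' a a'))"
    unfolding s3 by (rule partial_trace_tensor_map[OF D finBs(2,3) slice_ops[OF \<rho>']])
  also have "\<dots> = D T (tensor_pow n A (Pi\<^sub>E T B) (marginal_channel K B N T) Y)"
    by (simp only: s1 s2 partial_trace_split_systems_tensor_pow[OF T fin(2)])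
  also have "\<dots> = slice (compound_state A (\<lambda>T. Pi\<^sub>E T B) (marginal_channel K B N) n d F D T \<phi>) a a'"
    unfolding compound_state_def Y_def using slice_tensor_map[OF lin_M _ _ \<phi>] by simp
  finally show "slice (qss_reduced_state A B K N n d F D T \<phi>) a a' = \<dots>" .
qed

section \<open>From equal output states to equal capacities\<close>

lemma pure_state_in_ops: "unit_vec I \<phi> \<Longrightarrow> pure_state \<phi> \<in> ops I"
  by (auto simp: unit_vec_def pure_state_def ops_def)

lemma access_structure_finite_nonempty:
  assumes "access_structure K \<A>"
  shows "\<A> \<subseteq> Pow {1..K}" and "finite \<A>" and "\<A> \<noteq> {}"
proof -
  obtain \<Z> where Z: "adversary_structure K \<Z>" and A: "\<A> = Pow {1..K} - \<Z>"
    using assms by (auto simp: access_structure_def)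
  show sub: "\<A> \<subseteq> Pow {1..K}" using A by blast
  show "finite \<A>" by (rule finite_subset[OF sub]) simp
  have "\<forall>Z. Z \<subseteq> {1..K} \<longrightarrow> (Z \<in> \<Z> \<longleftrightarrow> {1..K} - Z \<notin> \<Z>)"
    using Z unfolding adversary_structure_def by blast
  \<comment> \<open>Self-duality at the empty set: the empty set and the full set cannot both be
    adversarial, so one of them is qualified.\<close>
  from spec[OF this, of "{}"] have "{} \<in> \<Z> \<longleftrightarrow> {1..K} \<notin> \<Z>" by simp
  then show "\<A> \<noteq> {}" using A by blast
qed

theorem theorem3:
  fixes A :: "'a set" and B :: "nat \<Rightarrow> 'b set" and K :: nat
    and N :: "('a, nat \<Rightarrow> 'b) superop" and \<A> :: "nat set set"
  assumes "finite A" and "A \<noteq> {}"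
    and "\<And>k. k \<in> {1..K} \<Longrightarrow> finite (B k) \<and> B k \<noteq> {}"
    and "channel A (Pi\<^sub>E {1..K} B) N"
    and "access_structure K \<A>"
  shows "qss_capacity A B K N \<A> =
         compound_capacity A (\<lambda>T. Pi\<^sub>E T B) (marginal_channel K B N) \<A>"
proof -
  note \<A> = access_structure_finite_nonempty[OF assms(5)]
  have code: "compound_code A (\<lambda>T. Pi\<^sub>E T B) \<A> R n F D \<longleftrightarrow> qss_code A B \<A> R n F D" for R n F D
    by (simp add: compound_code_def qss_code_def)
  \<comment> \<open>The states are compared only for valid codes and unit vectors: the code supplies
    linearity of \<open>F\<close> and \<open>D T\<close>, the unit vector supplies the support of
    \<open>pure_state \<phi>\<close>.\<close>
  have state: "qss_reduced_state A B K N n (code_dim n R) F D T \<phi> =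
      compound_state A (\<lambda>T. Pi\<^sub>E T B) (marginal_channel K B N) n (code_dim n R) F D T \<phi>"
    if "qss_code A B \<A> R n F D" "T \<in> \<A>" "unit_vec ({..<code_dim n R} \<times> {..<code_dim n R}) \<phi>"
    for n R F D T \<phi>
  proof (rule qss_reduced_state_eq_compound_state)
    show "pure_state \<phi> \<in> ops ({..<code_dim n R} \<times> {..<code_dim n R})"
      by (rule pure_state_in_ops[OF that(3)])
  qed (use assms(1,3) \<A>(1) that(1,2) in \<open>auto simp: qss_code_def channel_def\<close>)
  \<comment> \<open>The criteria agree already for a fixed code and a fixed error bound. Since
    \<open>\<A>\<close> is finite and nonempty, a lower bound on the minimum is a lower bound for
    every qualified set. Both notions of achievability use this at rate
    \<open>R - \<delta>\<close>.\<close>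
  have "(qss_code A B \<A> R n F D \<and>
        (\<forall>T\<in>\<A>. \<forall>\<phi>. let d = code_dim n R in unit_vec ({..<d} \<times> {..<d}) \<phi> \<longrightarrow>
           fidelity ({..<d} \<times> {..<d}) (pure_state \<phi>) (qss_reduced_state A B K N n d F D T \<phi>) \<ge> 1 - \<epsilon>))
    \<longleftrightarrow> (compound_code A (\<lambda>T. Pi\<^sub>E T B) \<A> R n F D \<and>
        (\<forall>\<phi>. let d = code_dim n R in unit_vec ({..<d} \<times> {..<d}) \<phi> \<longrightarrow>
           (MIN T\<in>\<A>. fidelity ({..<d} \<times> {..<d}) (pure_state \<phi>)
              (compound_state A (\<lambda>T. Pi\<^sub>E T B) (marginal_channel K B N) n d F D T \<phi>)) \<ge> 1 - \<epsilon>))"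
    for R n F D \<epsilon>
    unfolding code Let_def using \<A>(2,3) by (auto simp: state)
  then have "qss_achievable A B K N \<A> R \<longleftrightarrow>
      compound_achievable A (\<lambda>T. Pi\<^sub>E T B) (marginal_channel K B N) \<A> R" for R
    unfolding qss_achievable_def compound_achievable_def by simp
  then show ?thesis by (simp add: qss_capacity_def compound_capacity_def)
qed

end
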